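(* Let $n,k\ge 1$ and let $p:\mathbf{C}^n\to\mathbf{C}^k$ be a holomorphic polynomial mapping (not necessarily homogeneous) such that $\|p(z)\|^2<1$ for all $z$ on the unit sphere in $\mathbf{C}^n$. Then there is an integer $N>k$ and a holomorphic polynomial mapping $g:\mathbf{C}^n\to\mathbf{C}^{N-k}$ such that $p\oplus g:\mathbf{C}^n\to\mathbf{C}^N$ defines a proper holomorphic mapping from the unit ball $B_n$ to the unit ball $B_N$.
   Context: $\|\cdot\|$ denotes the complex Euclidean norm, $B_n$ is the open unit ball in $\mathbf{C}^n$, and $(p\oplus g)(z)=(p(z),g(z))$ is the orthogonal direct sum of the mappings. *)

theory Defs
  imports "HOL-Analysis.Analysis"
begin

text \<open>
  The source space \<open>\<complex>\<^sup>n\<close> is \<open>complex^'n\<close>, whose norm is the Euclidean one. The dimension \<open>N\<close> of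
  the target is existentially quantified and so cannot be a type: \<open>\<complex>\<^sup>N\<close> is the set of functions
  \<open>nat \<Rightarrow> complex\<close> vanishing from \<open>N\<close> on. The product topology of the ambient type induces on this
  set the usual topology of \<open>\<complex>\<^sup>N\<close>.
\<close>

definition cspace :: "nat \<Rightarrow> (nat \<Rightarrow> complex) set" where
  "cspace N = {w. \<forall>i\<ge>N. w i = 0}"

definition cnorm :: "nat \<Rightarrow> (nat \<Rightarrow> complex) \<Rightarrow> real" where
  "cnorm N w = L2_set (\<lambda>i. cmod (w i)) {..<N}"

definition unit_ball :: "nat \<Rightarrow> (nat \<Rightarrow> complex) set" where
  "unit_ball N = {w \<in> cspace N. cnorm N w < 1}"

text \<open>A multi-index is a function \<open>\<alpha> :: 'n \<Rightarrow> nat\<close>, and \<open>z\<^sup>\<alpha>\<close> is the product of the \<open>z $ i ^ \<alpha> i\<close>.\<close>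

definition polynomial_fun :: "(complex^'n \<Rightarrow> complex) \<Rightarrow> bool" where
  "polynomial_fun f \<longleftrightarrow>
     (\<exists>(A :: ('n \<Rightarrow> nat) set) c. finite A \<and> (\<forall>z. f z = (\<Sum>\<alpha>\<in>A. c \<alpha> * (\<Prod>i\<in>UNIV. z $ i ^ \<alpha> i))))"

definition polynomial_map :: "nat \<Rightarrow> (complex^'n \<Rightarrow> nat \<Rightarrow> complex) \<Rightarrow> bool" where
  "polynomial_map N f \<longleftrightarrow> (\<forall>z. f z \<in> cspace N) \<and> (\<forall>j<N. polynomial_fun (\<lambda>z. f z j))"

text \<open>Real differentiability with a complex linear derivative.\<close>

definition holomorphic_fun_on :: "(complex^'n \<Rightarrow> complex) \<Rightarrow> (complex^'n) set \<Rightarrow> bool" where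
  "holomorphic_fun_on f U \<longleftrightarrow>
     (\<forall>z\<in>U. \<exists>D. (f has_derivative D) (at z) \<and> (\<forall>a v. D (a *s v) = a * D v))"

definition holomorphic_map_on :: "nat \<Rightarrow> (complex^'n \<Rightarrow> nat \<Rightarrow> complex) \<Rightarrow> (complex^'n) set \<Rightarrow> bool" where
  "holomorphic_map_on N f U \<longleftrightarrow>
     (\<forall>z\<in>U. f z \<in> cspace N) \<and> (\<forall>j<N. holomorphic_fun_on (\<lambda>z. f z j) U)"

definition proper_holomorphic_ball_map :: "nat \<Rightarrow> (complex^'n \<Rightarrow> nat \<Rightarrow> complex) \<Rightarrow> bool" where
  "proper_holomorphic_ball_map N f \<longleftrightarrow>
     holomorphic_map_on N f (ball 0 1) \<and>
     f ` ball 0 1 \<subseteq> unit_ball N \<and>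
     proper_map (top_of_set (ball 0 1)) (top_of_set (unit_ball N)) f"

text \<open>
  The library's notion of properness (closed with compact fibres) agrees here with the usual one,
  that preimages of compact sets are compact.
\<close>

lemma proper_ball_map_iff_compact_preimage:
  fixes f :: "complex^'n \<Rightarrow> nat \<Rightarrow> complex"
  assumes hol: "holomorphic_map_on N f (ball 0 1)" and im: "f ` ball 0 1 \<subseteq> unit_ball N"
  shows "proper_map (top_of_set (ball 0 1)) (top_of_set (unit_ball N)) f \<longleftrightarrow>
           (\<forall>K. K \<subseteq> unit_ball N \<and> compact K \<longrightarrow> compact {z \<in> ball 0 1. f z \<in> K})"
proof -
  let ?X = "top_of_set (ball 0 1 :: (complex^'n) set)" and ?Y = "top_of_set (unit_ball N)"
  have "continuous_on (ball 0 1) (\<lambda>z. f z j)" for j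
  proof (cases "j < N")
    case True
    then show ?thesis
      using hol unfolding holomorphic_map_on_def holomorphic_fun_on_def
      by (meson continuous_at_imp_continuous_on has_derivative_continuous)
  next
    case False
    then have "f z j = 0" if "z \<in> ball 0 1" for z
      using hol that unfolding holomorphic_map_on_def cspace_def by auto
    then show ?thesis
      by (metis (no_types, lifting) continuous_on_cong continuous_on_const)
  qed
  then have "continuous_on (ball 0 1) f"
    by (rule continuous_on_coordinatewise_then_product)
  then have cont: "continuous_map ?X ?Y f"
    using im by (simp add: continuous_map_in_subtopology image_subset_iff_funcset)
  have "metrizable_space ?Y"
    by (simp add: metrizable_space_euclidean metrizable_space_subtopology)
  then have "k_space ?Y" "kc_space ?Y"
    by (simp_all add: metrizable_imp_k_space metrizable_imp_Hausdorff_space Hausdorff_imp_kc_space)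
  then have "proper_map ?X ?Y f \<longleftrightarrow>
      (\<forall>K. compactin ?Y K \<longrightarrow> compactin ?X {z \<in> topspace ?X. f z \<in> K})"
    using cont im by (subst proper_eq_compact_map) auto
  then show ?thesis
    by (auto simp: compactin_subtopology)
qed

text \<open>\<open>k\<close> is the target dimension of \<open>p\<close>; the coordinates of \<open>g\<close> are placed after those of \<open>p\<close>.\<close>

definition direct_sum_map ::
    "nat \<Rightarrow> (complex^'n \<Rightarrow> nat \<Rightarrow> complex) \<Rightarrow> (complex^'n \<Rightarrow> nat \<Rightarrow> complex)
      \<Rightarrow> complex^'n \<Rightarrow> nat \<Rightarrow> complex" where
  "direct_sum_map k p g z = (\<lambda>i. if i < k then p z i else g z (i - k))"

end

theory Submission
  imports Defs "HOL-Complex_Analysis.Conformal_Mappings"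
begin

text \<open>
  Functions that agree on the sphere with a finite sum \<open>\<Sum>|h\<^sub>j|\<^sup>2\<close>, \<open>h\<^sub>j\<close> holomorphic polynomials,
  form a semiring containing \<open>1 \<plusminus> Re z\<^sub>i\<close> and \<open>1 \<plusminus> Im z\<^sub>i\<close>. A real polynomial that is positive on a
  cube has nonnegative coefficients in the Bernstein basis of large degree, hence is a
  nonnegative combination of products of such factors. So \<open>1 - \<parallel>p\<parallel>\<^sup>2\<close> lies in the semiring, say
  \<open>1 - \<parallel>p\<parallel>\<^sup>2 = \<parallel>h\<parallel>\<^sup>2\<close> on the sphere, and \<open>g = z \<otimes> h\<close> works by the maximum principle.
\<close>

subsection \<open>Bernstein coefficients on a cube\<close>

text \<open>Sums of monomials rather than a ring closure: the induction for the Bernstein expansion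
  then has only monomials and sums to treat. The index type is arbitrary because the real
  coordinates of \<open>complex^'n\<close> will be indexed by
  \<open>'n \<times> bool\<close>.\<close>

inductive real_mpoly :: "(('i::finite \<Rightarrow> real) \<Rightarrow> real) \<Rightarrow> bool" where
  monomial: "real_mpoly (\<lambda>t. c * (\<Prod>i\<in>UNIV. t i ^ \<alpha> i))"
| add: "real_mpoly F \<Longrightarrow> real_mpoly G \<Longrightarrow> real_mpoly (\<lambda>t. F t + G t)"

lemma real_mpoly_const: "real_mpoly (\<lambda>_. c)"
  using real_mpoly.monomial[of c "\<lambda>_. 0"] by simp

lemma real_mpoly_coord: "real_mpoly (\<lambda>t. t i)"
proof -
  have "(\<Prod>j\<in>UNIV. t j ^ (if j = i then 1 else 0)) = t i" for t :: "'a \<Rightarrow> real"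
    by (simp add: if_distrib[of "\<lambda>e. _ ^ e"] cong: if_cong)
  then show ?thesis
    using real_mpoly.monomial[of 1 "\<lambda>j. if j = i then 1 else 0"] by simp
qed

lemma real_mpoly_mult:
  assumes "real_mpoly F" "real_mpoly G"
  shows "real_mpoly (\<lambda>t. F t * G t)"
  using assms(1)
proof induction
  case (monomial c \<alpha>)
  show ?case
    using assms(2)
  proof induction
    case (monomial d \<beta>)
    have "(\<lambda>t. c * (\<Prod>i\<in>UNIV. t i ^ \<alpha> i) * (d * (\<Prod>i\<in>UNIV. t i ^ \<beta> i))) =
        (\<lambda>t. c * d * (\<Prod>i\<in>UNIV. t i ^ (\<alpha> i + \<beta> i)))"
      by (simp add: power_add prod.distrib mult_ac)
    then show ?case
      by (simp only: real_mpoly.monomial)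
  next
    case (add F G)
    then show ?case
      by (simp add: distrib_left real_mpoly.add)
  qed
next
  case (add F G)
  then show ?case
    by (simp add: distrib_right real_mpoly.add)
qed

lemma real_mpoly_diff:
  assumes "real_mpoly F" "real_mpoly G"
  shows "real_mpoly (\<lambda>t. F t - G t)"
  using real_mpoly.add[OF assms(1) real_mpoly_mult[OF real_mpoly_const[of "-1"] assms(2)]]
  by simp

lemma real_mpoly_power2: "real_mpoly F \<Longrightarrow> real_mpoly (\<lambda>t. (F t)\<^sup>2)"
  by (simp add: power2_eq_square real_mpoly_mult)

lemma real_mpoly_sum:
  "(\<And>j. j \<in> J \<Longrightarrow> real_mpoly (F j)) \<Longrightarrow> real_mpoly (\<lambda>t. \<Sum>j\<in>J. F j t)"
  by (induction J rule: infinite_finite_induct) (auto simp: real_mpoly_const real_mpoly.add)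

section \<open>Bernstein coefficients of monomials and their limits\<close>

text \<open>The coefficient of \<open>t ^ a\<close> at index \<open>k\<close> in the Bernstein basis
  of degree \<open>N\<close>. Since subtraction on \<open>nat\<close> is truncated, it is 0 for
  \<open>k < a \<le> N\<close>: the factor with \<open>j = k\<close> vanishes.\<close>

definition falling_ratio :: "nat \<Rightarrow> nat \<Rightarrow> nat \<Rightarrow> real" where
  "falling_ratio N a k = (\<Prod>j<a. real (k - j) / real (N - j))"

text \<open>The product form can be compared with \<open>(k / N) ^ a\<close> factor by factor; the
  quotient of binomial coefficients is the form that fits the Bernstein polynomials.\<close>

lemma falling_ratio_choose:
  assumes "a \<le> N"
  shows "falling_ratio N a k = real (k choose a) / real (N choose a)"
proof (cases "a \<le> k")
  case True
  have *: "real (n choose a) = (\<Prod>j<a. real (n - j)) / (\<Prod>j<a. real (a - j))" if "a \<le> n" for n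
    using binomial_altdef_of_nat[OF that, where 'a=real] by (simp add: prod_dividef atLeast0LessThan)
  have "(\<Prod>j<a. real (a - j)) \<noteq> 0"
    by auto
  then show ?thesis
    by (simp add: *[OF True] *[OF assms] falling_ratio_def prod_dividef)
next
  case False
  then have "falling_ratio N a k = 0"
    unfolding falling_ratio_def by (intro prod_zero) (auto intro!: bexI[of _ k])
  then show ?thesis
    using False by simp
qed

text \<open>Both products have \<open>a\<close> factors in \<open>[0, 1]\<close>, and corresponding
  factors differ by at most \<open>a / N\<close>, so the products differ by at most the sum of these
  errors.\<close>

lemma falling_ratio_approx:
  assumes "k \<le> N" "a \<le> N"
  shows "\<bar>falling_ratio N a k - (real k / real N) ^ a\<bar> \<le> real a * (real a / real N)"
    and "\<bar>falling_ratio N a k\<bar> \<le> 1"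
proof -
  have le1: "norm (real (k - j) / real (N - j)) \<le> 1" if "j < a" for j
    using that assms by (simp add: divide_simps)
  have close: "norm (real (k - j) / real (N - j) - real k / real N) \<le> real a / real N" if "j < a" for j
  proof (cases "j \<le> k")
    case True
    have pos: "real N > 0" "real N - real j > 0"
      using that assms by auto
    \<comment> \<open>The last quotient is at most 1 because \<open>j \<le> k \<le> N\<close>, so
      the error of one factor is at most \<open>j / N\<close>.\<close>
    have "real k / real N - real (k - j) / real (N - j) = real j / real N * ((real N - real k) / (real N - real j))"
      using pos True that assms by (simp add: of_nat_diff field_simps)
    moreover have "(real N - real k) / (real N - real j) \<le> 1" "(real N - real k) / (real N - real j) \<ge> 0"
      using pos True assms by (simp_all add: field_simps)
    then have "real j / real N * ((real N - real k) / (real N - real j)) \<le> real j / real N"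
        "real j / real N * ((real N - real k) / (real N - real j)) \<ge> 0"
      by (intro mult_left_le mult_nonneg_nonneg; simp)+
    moreover have "real j / real N \<le> real a / real N"
      using that by (simp add: divide_right_mono)
    ultimately show ?thesis
      by (metis abs_minus_commute abs_of_nonneg order_trans real_norm_def)
  next
    \<comment> \<open>The truncated numerator is 0 here, and \<open>k < j < a\<close> bounds
      \<open>k / N\<close> itself.\<close>
    case False
    then show ?thesis
      using that by (simp add: divide_right_mono)
  qed
  have "norm (falling_ratio N a k - (\<Prod>j<a. real k / real N)) \<le>
      (\<Sum>j<a. norm (real (k - j) / real (N - j) - real k / real N))"
    unfolding falling_ratio_def using assms le1
    by (intro norm_prod_diff) (auto simp: divide_simps)
  also have "\<dots> \<le> (\<Sum>j<a. real a / real N)"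
    using close by (intro sum_mono) auto
  finally show "\<bar>falling_ratio N a k - (real k / real N) ^ a\<bar> \<le> real a * (real a / real N)"
    by simp
  have "\<bar>falling_ratio N a k\<bar> = (\<Prod>j<a. norm (real (k - j) / real (N - j)))"
    by (simp add: falling_ratio_def abs_prod)
  also have "\<dots> \<le> 1"
    using le1 by (intro prod_le_1) auto
  finally show "\<bar>falling_ratio N a k\<bar> \<le> 1" .
qed

text \<open>Multiply \<open>t ^ a\<close> by \<open>(t + (1 - t)) ^ (N - a) = 1\<close> and expand;
  the identity for products of binomial coefficients turns the result into Bernstein polynomials of
  degree \<open>N\<close>.\<close>

lemma power_eq_sum_Bernstein:
  assumes "a \<le> N"
  shows "(\<Sum>k\<le>N. falling_ratio N a k * Bernstein N k t) = t ^ a"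
proof -
  have "(\<Sum>k\<le>N. falling_ratio N a k * Bernstein N k t) =
      (\<Sum>k=a..N. falling_ratio N a k * Bernstein N k t)"
    using assms by (intro sum.mono_neutral_right) (auto simp: falling_ratio_choose)
  also have "\<dots> = (\<Sum>k=a..N. t ^ a * (real (N - a choose (k - a)) * t ^ (k - a) * (1 - t) ^ (N - k)))"
  proof (rule sum.cong[OF refl])
    fix k assume k: "k \<in> {a..N}"
    have "real (N choose k) * real (k choose a) = real (N choose a) * real (N - a choose (k - a))"
      using choose_mult[of a k N] k by (metis atLeastAtMost_iff of_nat_mult)
    moreover have "real (N choose a) \<noteq> 0"
      using assms by simp
    ultimately have "falling_ratio N a k * real (N choose k) = real (N - a choose (k - a))"
      using assms by (simp add: falling_ratio_choose field_simps)
    moreover have "t ^ k = t ^ a * t ^ (k - a)"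
      using k by (simp flip: power_add)
    ultimately show "falling_ratio N a k * Bernstein N k t =
        t ^ a * (real (N - a choose (k - a)) * t ^ (k - a) * (1 - t) ^ (N - k))"
      by (simp add: Bernstein_def mult_ac)
  qed
  also have "\<dots> = t ^ a * (\<Sum>k\<le>N - a. real (N - a choose k) * t ^ k * (1 - t) ^ (N - a - k))"
    unfolding sum_distrib_left
    by (rule sum.reindex_bij_witness[of _ "\<lambda>k. k + a" "\<lambda>k. k - a"]) (use assms in auto)
  also have "\<dots> = t ^ a"
    using binomial_ring[of t "1 - t" "N - a"] by simp
  finally show ?thesis .
qed

text \<open>A monomial is expanded one variable at a time, and its coefficients approach its values
  at the grid points \<open>\<kappa> / N\<close>. The claim is made for all large \<open>N\<close>
  so that two summands can be expanded in a common degree and their coefficients added.\<close>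

lemma real_mpoly_Bernstein_approx:
  fixes F :: "('i::finite \<Rightarrow> real) \<Rightarrow> real"
  assumes "real_mpoly F" "\<epsilon> > 0"
  shows "\<forall>\<^sub>F N in sequentially. \<exists>c.
      (\<forall>t. F t = (\<Sum>\<kappa>\<in>UNIV \<rightarrow>\<^sub>E {..N}. c \<kappa> * (\<Prod>i\<in>UNIV. Bernstein N (\<kappa> i) (t i)))) \<and>
      (\<forall>\<kappa>\<in>UNIV \<rightarrow>\<^sub>E {..N}. \<bar>c \<kappa> - F (\<lambda>i. real (\<kappa> i) / real N)\<bar> \<le> \<epsilon>)"
  using assms
proof (induction arbitrary: \<epsilon>)
  case (monomial b \<alpha>)
  \<comment> \<open>The error is at most \<open>\<bar>b\<bar> * s / N\<close>: variable
    \<open>i\<close> contributes \<open>\<alpha> i * \<alpha> i / N\<close>.\<close>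
  define s where "s = (\<Sum>i\<in>UNIV. real (\<alpha> i) * real (\<alpha> i))"
  have "(\<lambda>N. \<bar>b\<bar> * s / real N) \<longlonglongrightarrow> 0"
    by (rule lim_const_over_n)
  then have "\<forall>\<^sub>F N in sequentially. \<bar>b\<bar> * s / real N < \<epsilon>"
    using monomial by (rule order_tendstoD)
  \<comment> \<open>Once \<open>N\<close> reaches the total degree, every single exponent is at most
    \<open>N\<close>, as the one-variable expansion demands.\<close>
  moreover have "\<forall>\<^sub>F N in sequentially. (\<Sum>i\<in>UNIV. \<alpha> i) \<le> N"
    by (rule eventually_ge_at_top)
  ultimately show ?case
  proof eventually_elim
    case (elim N)
    have \<alpha>: "\<alpha> i \<le> N" for i
      using member_le_sum[of i UNIV \<alpha>] elim(2) by simp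
    define c where "c \<kappa> = b * (\<Prod>i\<in>UNIV. falling_ratio N (\<alpha> i) (\<kappa> i))" for \<kappa>
    have "b * (\<Prod>i\<in>UNIV. t i ^ \<alpha> i) =
        (\<Sum>\<kappa>\<in>UNIV \<rightarrow>\<^sub>E {..N}. c \<kappa> * (\<Prod>i\<in>UNIV. Bernstein N (\<kappa> i) (t i)))" for t
    proof -
      have "(\<Prod>i\<in>UNIV. t i ^ \<alpha> i) =
          (\<Prod>i\<in>UNIV. \<Sum>k\<le>N. falling_ratio N (\<alpha> i) k * Bernstein N k (t i))"
        by (simp add: power_eq_sum_Bernstein \<alpha>)
      also have "\<dots> = (\<Sum>\<kappa>\<in>UNIV \<rightarrow>\<^sub>E {..N}. \<Prod>i\<in>UNIV. falling_ratio N (\<alpha> i) (\<kappa> i) * Bernstein N (\<kappa> i) (t i))"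
        by (rule prod_sum_PiE) auto
      finally show ?thesis
        by (simp add: c_def prod.distrib sum_distrib_left mult.assoc)
    qed
    moreover have "\<bar>c \<kappa> - b * (\<Prod>i\<in>UNIV. (real (\<kappa> i) / real N) ^ \<alpha> i)\<bar> \<le> \<epsilon>"
      if "\<kappa> \<in> UNIV \<rightarrow>\<^sub>E {..N}" for \<kappa>
    proof -
      have \<kappa>: "\<kappa> i \<le> N" for i
        using that by auto
      have "norm ((\<Prod>i\<in>UNIV. falling_ratio N (\<alpha> i) (\<kappa> i)) - (\<Prod>i\<in>UNIV. (real (\<kappa> i) / real N) ^ \<alpha> i)) \<le>
          (\<Sum>i\<in>UNIV. norm (falling_ratio N (\<alpha> i) (\<kappa> i) - (real (\<kappa> i) / real N) ^ \<alpha> i))"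
        using falling_ratio_approx(2)[OF \<kappa> \<alpha>] \<kappa>
        by (intro norm_prod_diff) (auto simp: divide_simps power_mono)
      also have "\<dots> \<le> (\<Sum>i\<in>UNIV. real (\<alpha> i) * (real (\<alpha> i) / real N))"
        using falling_ratio_approx(1)[OF \<kappa> \<alpha>] by (intro sum_mono) simp
      also have "\<dots> = s / real N"
        by (simp add: s_def sum_divide_distrib)
      finally have "\<bar>b\<bar> * \<bar>(\<Prod>i\<in>UNIV. falling_ratio N (\<alpha> i) (\<kappa> i)) - (\<Prod>i\<in>UNIV. (real (\<kappa> i) / real N) ^ \<alpha> i)\<bar>
          \<le> \<bar>b\<bar> * (s / real N)"
        by (intro mult_left_mono) auto
      then show ?thesis
        using elim(1) by (simp add: c_def flip: abs_mult right_diff_distrib)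
    qed
    ultimately show ?case
      by blast
  qed
next
  case (add F G)
  have "\<epsilon> / 2 > 0"
    using add.prems by simp
  from add.IH(1)[OF this] add.IH(2)[OF this] show ?case
  proof eventually_elim
    case (elim N)
    from elim(1) obtain c where
      c: "\<forall>t. F t = (\<Sum>\<kappa>\<in>UNIV \<rightarrow>\<^sub>E {..N}. c \<kappa> * (\<Prod>i\<in>UNIV. Bernstein N (\<kappa> i) (t i)))"
        "\<forall>\<kappa>\<in>UNIV \<rightarrow>\<^sub>E {..N}. \<bar>c \<kappa> - F (\<lambda>i. real (\<kappa> i) / real N)\<bar> \<le> \<epsilon> / 2"
      by (elim exE conjE) (rule that)
    from elim(2) obtain d where
      d: "\<forall>t. G t = (\<Sum>\<kappa>\<in>UNIV \<rightarrow>\<^sub>E {..N}. d \<kappa> * (\<Prod>i\<in>UNIV. Bernstein N (\<kappa> i) (t i)))"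
        "\<forall>\<kappa>\<in>UNIV \<rightarrow>\<^sub>E {..N}. \<bar>d \<kappa> - G (\<lambda>i. real (\<kappa> i) / real N)\<bar> \<le> \<epsilon> / 2"
      by (elim exE conjE) (rule that)
    show ?case
    proof (intro exI[of _ "\<lambda>\<kappa>. c \<kappa> + d \<kappa>"] conjI allI ballI)
      show "F t + G t = (\<Sum>\<kappa>\<in>UNIV \<rightarrow>\<^sub>E {..N}. (c \<kappa> + d \<kappa>) * (\<Prod>i\<in>UNIV. Bernstein N (\<kappa> i) (t i)))" for t
        unfolding c(1)[rule_format, of t] d(1)[rule_format, of t] by (simp add: distrib_right sum.distrib)
      show "\<bar>c \<kappa> + d \<kappa> - (F (\<lambda>i. real (\<kappa> i) / real N) + G (\<lambda>i. real (\<kappa> i) / real N))\<bar> \<le> \<epsilon>"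
        if "\<kappa> \<in> UNIV \<rightarrow>\<^sub>E {..N}" for \<kappa>
        using c(2)[rule_format, OF that] d(2)[rule_format, OF that] by linarith
    qed
  qed
qed

text \<open>In large degree each coefficient is within \<open>\<delta>\<close> of a value of
  \<open>F\<close> at a grid point of the cube, and that value is at least
  \<open>\<delta>\<close>.\<close>

lemma real_mpoly_nonneg_Bernstein_coeffs:
  fixes F :: "('i::finite \<Rightarrow> real) \<Rightarrow> real"
  assumes F: "real_mpoly F" and \<delta>: "\<delta> > 0" and pos: "\<forall>t. (\<forall>i. 0 \<le> t i \<and> t i \<le> 1) \<longrightarrow> F t \<ge> \<delta>"
  shows "\<exists>N c. (\<forall>\<kappa>\<in>UNIV \<rightarrow>\<^sub>E {..N}. c \<kappa> \<ge> 0) \<and>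
    (\<forall>t. F t = (\<Sum>\<kappa>\<in>UNIV \<rightarrow>\<^sub>E {..N}. c \<kappa> * (\<Prod>i\<in>UNIV. Bernstein N (\<kappa> i) (t i))))"
proof -
  obtain N c where
    c: "\<forall>t. F t = (\<Sum>\<kappa>\<in>UNIV \<rightarrow>\<^sub>E {..N}. c \<kappa> * (\<Prod>i\<in>UNIV. Bernstein N (\<kappa> i) (t i)))"
      "\<forall>\<kappa>\<in>UNIV \<rightarrow>\<^sub>E {..N}. \<bar>c \<kappa> - F (\<lambda>i. real (\<kappa> i) / real N)\<bar> \<le> \<delta>"
    using eventually_happens'[OF sequentially_bot real_mpoly_Bernstein_approx[OF F \<delta>]]
    by (elim exE conjE) (rule that)
  have "c \<kappa> \<ge> 0" if "\<kappa> \<in> UNIV \<rightarrow>\<^sub>E {..N}" for \<kappa>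
  proof -
    have "\<kappa> i \<le> N" for i
      using that by auto
    then have "F (\<lambda>i. real (\<kappa> i) / real N) \<ge> \<delta>"
      by (intro pos[rule_format]) (auto simp: divide_simps)
    then show ?thesis
      using c(2)[rule_format, OF that] by linarith
  qed
  with c(1) show ?thesis
    by (intro exI[of _ N] exI[of _ c]) simp
qed

subsection \<open>Holomorphic polynomials\<close>

text \<open>Exponents may repeat in the family; terms with equal exponent are collected. This spares
  the closure proofs for sums and products from tracking coincidences.\<close>

lemma polynomial_fun_sum_monomials:
  fixes \<alpha> :: "'j \<Rightarrow> 'n::finite \<Rightarrow> nat"
  assumes "finite J"
  shows "polynomial_fun (\<lambda>z. \<Sum>j\<in>J. c j * (\<Prod>i\<in>UNIV. z $ i ^ \<alpha> j i))"
proof -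
  have "(\<Sum>j\<in>J. c j * (\<Prod>i\<in>UNIV. z $ i ^ \<alpha> j i)) =
      (\<Sum>a\<in>\<alpha> ` J. (\<Sum>j | j \<in> J \<and> \<alpha> j = a. c j) * (\<Prod>i\<in>UNIV. z $ i ^ a i))" for z :: "complex^'n"
    unfolding sum.image_gen[OF assms, of _ \<alpha>] sum_distrib_right
    by (intro sum.cong) auto
  then show ?thesis
    unfolding polynomial_fun_def using assms
    by (intro exI[of _ "\<alpha> ` J"] exI[of _ "\<lambda>a. \<Sum>j | j \<in> J \<and> \<alpha> j = a. c j"]) simp
qed

lemma polynomial_fun_const: "polynomial_fun (\<lambda>_. c)"
  using polynomial_fun_sum_monomials[of "{()}" "\<lambda>_. c" "\<lambda>_ _. 0"] by simp

lemma polynomial_fun_coord: "polynomial_fun (\<lambda>z. z $ i)"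
proof -
  have "(\<Prod>j\<in>UNIV. z $ j ^ (if j = i then 1 else 0)) = z $ i" for z :: "complex^'a"
    by (simp add: if_distrib[of "\<lambda>e. _ ^ e"] cong: if_cong)
  then show ?thesis
    using polynomial_fun_sum_monomials[of "{()}" "\<lambda>_. 1" "\<lambda>_ j. if j = i then 1 else 0"] by simp
qed

lemma polynomial_fun_add:
  assumes "polynomial_fun f" "polynomial_fun g"
  shows "polynomial_fun (\<lambda>z. f z + g z)"
proof -
  obtain A c where A: "finite A" and f: "\<And>z. f z = (\<Sum>\<alpha>\<in>A. c \<alpha> * (\<Prod>i\<in>UNIV. z $ i ^ \<alpha> i))"
    using assms(1) unfolding polynomial_fun_def by blast
  obtain B d where B: "finite B" and g: "\<And>z. g z = (\<Sum>\<alpha>\<in>B. d \<alpha> * (\<Prod>i\<in>UNIV. z $ i ^ \<alpha> i))"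
    using assms(2) unfolding polynomial_fun_def by blast
  have "f z + g z = (\<Sum>j\<in>A <+> B. case_sum c d j * (\<Prod>i\<in>UNIV. z $ i ^ case_sum id id j i))" for z
    using A B by (simp add: f g sum.Plus)
  then show ?thesis
    using A B by (simp add: polynomial_fun_sum_monomials)
qed

lemma polynomial_fun_mult:
  assumes "polynomial_fun f" "polynomial_fun g"
  shows "polynomial_fun (\<lambda>z. f z * g z)"
proof -
  obtain A c where A: "finite A" and f: "\<And>z. f z = (\<Sum>\<alpha>\<in>A. c \<alpha> * (\<Prod>i\<in>UNIV. z $ i ^ \<alpha> i))"
    using assms(1) unfolding polynomial_fun_def by blast
  obtain B d where B: "finite B" and g: "\<And>z. g z = (\<Sum>\<alpha>\<in>B. d \<alpha> * (\<Prod>i\<in>UNIV. z $ i ^ \<alpha> i))"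
    using assms(2) unfolding polynomial_fun_def by blast
  have "f z * g z =
      (\<Sum>j\<in>A \<times> B. (c (fst j) * d (snd j)) * (\<Prod>i\<in>UNIV. z $ i ^ (fst j i + snd j i)))" for z
    by (simp add: f g sum_product sum.cartesian_product power_add prod.distrib case_prod_unfold mult_ac)
  then show ?thesis
    using A B by (simp add: polynomial_fun_sum_monomials)
qed

lemma polynomial_fun_induct [consumes 1, case_names const coord add mult]:
  assumes f: "polynomial_fun f"
    and const: "\<And>c. P (\<lambda>_. c)" and coord: "\<And>i. P (\<lambda>z. z $ i)"
    and add: "\<And>f g. P f \<Longrightarrow> P g \<Longrightarrow> P (\<lambda>z. f z + g z)"
    and mult: "\<And>f g. P f \<Longrightarrow> P g \<Longrightarrow> P (\<lambda>z. f z * g z)"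
  shows "P f"
proof -
  have pow: "P (\<lambda>z. z $ i ^ m)" for i m
    by (induction m) (simp_all add: const mult[OF coord])
  have prod: "P (\<lambda>z. \<Prod>i\<in>I. z $ i ^ \<alpha> i)" if "finite I" for I \<alpha>
    using that by induction (simp_all add: const mult[OF pow])
  have sum: "P (\<lambda>z. \<Sum>\<alpha>\<in>A. c \<alpha> * (\<Prod>i\<in>UNIV. z $ i ^ \<alpha> i))" if "finite A" for A c
    using that by induction (simp_all add: const add[OF mult[OF const prod]])
  obtain A c where "finite A" "f = (\<lambda>z. \<Sum>\<alpha>\<in>A. c \<alpha> * (\<Prod>i\<in>UNIV. z $ i ^ \<alpha> i))"
    using f unfolding polynomial_fun_def by blast
  then show ?thesis
    using sum by simp
qed

lemma polynomial_fun_imp_holomorphic_fun_on: "polynomial_fun f \<Longrightarrow> holomorphic_fun_on f U"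
proof (induction rule: polynomial_fun_induct)
  case (const c)
  then show ?case
    unfolding holomorphic_fun_on_def by (intro ballI exI[of _ "\<lambda>_. 0"]) auto
next
  case (coord i)
  then show ?case
    unfolding holomorphic_fun_on_def
    by (intro ballI exI[of _ "\<lambda>v. v $ i"])
      (auto intro!: bounded_linear_imp_has_derivative bounded_linear_vec_nth)
next
  case (add f g)
  show ?case
    unfolding holomorphic_fun_on_def
  proof
    fix z assume "z \<in> U"
    then obtain D E where "(f has_derivative D) (at z)" "\<forall>a v. D (a *s v) = a * D v"
      "(g has_derivative E) (at z)" "\<forall>a v. E (a *s v) = a * E v"
      using add unfolding holomorphic_fun_on_def by metis
    then show "\<exists>D. ((\<lambda>z. f z + g z) has_derivative D) (at z) \<and> (\<forall>a v. D (a *s v) = a * D v)"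
      by (intro exI[of _ "\<lambda>v. D v + E v"]) (auto intro: has_derivative_add simp: distrib_left)
  qed
next
  case (mult f g)
  show ?case
    unfolding holomorphic_fun_on_def
  proof
    fix z assume "z \<in> U"
    then obtain D E where "(f has_derivative D) (at z)" "\<forall>a v. D (a *s v) = a * D v"
      "(g has_derivative E) (at z)" "\<forall>a v. E (a *s v) = a * E v"
      using mult unfolding holomorphic_fun_on_def by metis
    then show "\<exists>D. ((\<lambda>z. f z * g z) has_derivative D) (at z) \<and> (\<forall>a v. D (a *s v) = a * D v)"
      by (intro exI[of _ "\<lambda>v. f z * E v + D v * g z"] conjI has_derivative_mult)
        (auto simp: algebra_simps)
  qed
qed

lemma continuous_on_polynomial_fun: "polynomial_fun f \<Longrightarrow> continuous_on S f"
  by (induction rule: polynomial_fun_induct)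
    (simp_all add: continuous_on_add continuous_on_mult continuous_on_component)

lemma holomorphic_on_polynomial_fun_line:
  assumes "polynomial_fun f"
  shows "(\<lambda>\<zeta>. f (\<zeta> *s v)) holomorphic_on S"
  using assms
proof (induction rule: polynomial_fun_induct)
  case (coord i)
  then show ?case
    by (simp add: vector_smult_component holomorphic_on_mult)
qed (simp_all add: holomorphic_on_add holomorphic_on_mult)

text \<open>Real and imaginary parts go through the induction together, since each part of a product
  involves both parts of the factors.\<close>

lemma real_mpoly_polynomial_fun:
  fixes w :: "('i::finite \<Rightarrow> real) \<Rightarrow> complex^'n"
  assumes "polynomial_fun f"
    and "\<And>i. real_mpoly (\<lambda>t. Re (w t $ i))" "\<And>i. real_mpoly (\<lambda>t. Im (w t $ i))"
  shows "real_mpoly (\<lambda>t. Re (f (w t))) \<and> real_mpoly (\<lambda>t. Im (f (w t)))"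
  using assms(1)
  by (induction rule: polynomial_fun_induct)
    (simp_all add: assms(2,3) real_mpoly_const real_mpoly.add real_mpoly_mult real_mpoly_diff)

section \<open>Euclidean norms and the maximum principle for polynomial maps\<close>

lemma norm_vec_power2: "(norm z)\<^sup>2 = (\<Sum>i\<in>UNIV. (norm (z $ i))\<^sup>2)"
  for z :: "'a::real_normed_vector^'n"
  by (simp add: norm_vec_def L2_set_def sum_nonneg)

lemma norm_vector_smult: "norm (a *s z) = cmod a * norm z" for z :: "complex^'n"
  by (simp add: norm_vec_def norm_mult L2_set_right_distrib)

lemma cnorm_power2: "(cnorm N w)\<^sup>2 = (\<Sum>i<N. (cmod (w i))\<^sup>2)"
  by (simp add: cnorm_def L2_set_def sum_nonneg)

text \<open>Pairing \<open>f\<close> with the fixed vector \<open>f z\<close> reduces the maximum principle for the norm to the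
  scalar one on the disc through \<open>z\<close>.\<close>

lemma polynomial_maximum_principle:
  fixes f :: "nat \<Rightarrow> complex^'n \<Rightarrow> complex"
  assumes f: "\<And>j. j < N \<Longrightarrow> polynomial_fun (f j)" and "s \<ge> 0"
    and bound: "\<And>z. norm z = 1 \<Longrightarrow> (\<Sum>j<N. (cmod (f j z))\<^sup>2) \<le> s"
    and z: "norm z \<le> 1"
  shows "(\<Sum>j<N. (cmod (f j z))\<^sup>2) \<le> s"
proof -
  obtain e :: "complex^'n" where e: "norm e = 1" "z = of_real (norm z) *s e"
  proof (cases "z = 0")
    \<comment> \<open>For \<open>z = 0\<close> any unit vector serves as the direction
      \<open>e\<close>.\<close>
    case True
    have "norm (axis undefined 1 :: complex^'n) = 1"
      by (simp add: norm_axis_1)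
    from that[OF this] True show ?thesis
      by (simp add: vec_eq_iff)
  next
    case False
    then have "z = of_real (norm z) *s (of_real (inverse (norm z)) *s z)"
      by (simp add: vec_eq_iff)
    moreover have "norm (of_real (inverse (norm z)) *s z) = 1"
      using False by (simp add: norm_vector_smult norm_inverse)
    ultimately show ?thesis
      using that by blast
  qed
  define n where "n = L2_set (\<lambda>j. cmod (f j z)) {..<N}"
  define \<phi> where "\<phi> \<zeta> = (\<Sum>j<N. cnj (f j z) * f j (\<zeta> *s e))" for \<zeta>
  have n: "n \<ge> 0" "n\<^sup>2 = (\<Sum>j<N. (cmod (f j z))\<^sup>2)"
    by (simp_all add: n_def L2_set_def sum_nonneg)
  have hol: "\<phi> holomorphic_on S" for S
    unfolding \<phi>_def by (intro holomorphic_intros holomorphic_on_polynomial_fun_line f) auto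
  have "cmod (\<phi> (of_real (norm z))) \<le> n * sqrt s"
  proof (rule maximum_modulus_frontier[where f = \<phi> and S = "cball 0 1"])
    fix \<zeta> :: complex assume "\<zeta> \<in> frontier (cball 0 1)"
    then have "norm (\<zeta> *s e) = 1"
      by (simp add: norm_vector_smult e)
    then have *: "L2_set (\<lambda>j. cmod (f j (\<zeta> *s e))) {..<N} \<le> sqrt s"
      using bound by (simp add: L2_set_def)
    have "cmod (\<phi> \<zeta>) \<le> (\<Sum>j<N. cmod (f j z) * cmod (f j (\<zeta> *s e)))"
      unfolding \<phi>_def by (intro sum_norm_le) (simp add: norm_mult)
    \<comment> \<open>The Cauchy-Schwarz inequality.\<close>
    also have "\<dots> \<le> n * L2_set (\<lambda>j. cmod (f j (\<zeta> *s e))) {..<N}"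
      using L2_set_mult_ineq[of "\<lambda>j. cmod (f j z)" "\<lambda>j. cmod (f j (\<zeta> *s e))" "{..<N}"]
      by (simp add: n_def)
    also have "\<dots> \<le> n * sqrt s"
      using * n(1) by (rule mult_left_mono)
    finally show "cmod (\<phi> \<zeta>) \<le> n * sqrt s" .
  qed (use z in \<open>simp_all add: hol holomorphic_on_imp_continuous_on\<close>)
  \<comment> \<open>At the parameter of \<open>z\<close> the pairing is that of \<open>f z\<close>
    with itself, so the bound on the disc reads \<open>n * n \<le> n * sqrt s\<close>, and one
    factor \<open>n\<close> cancels unless it is 0.\<close>
  moreover have "\<phi> (of_real (norm z)) = of_real (n\<^sup>2)"
    unfolding \<phi>_def n(2) e(2)[symmetric] by (simp add: mult.commute flip: complex_norm_square)
  ultimately have "n * n \<le> n * sqrt s"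
    by (simp add: power2_eq_square norm_mult n(1))
  then have "n \<le> sqrt s"
    using n(1) \<open>s \<ge> 0\<close> by (cases "n = 0") auto
  then have "n\<^sup>2 \<le> s"
    using n(1) \<open>s \<ge> 0\<close> by (metis power_mono real_sqrt_pow2)
  then show ?thesis
    by (simp add: n(2))
qed

subsection \<open>The semiring of sums of squared moduli on the sphere\<close>

text \<open>A list keeps multiplicities, so that addition is concatenation even when a polynomial
  occurs twice.\<close>

definition sphere_sos :: "(complex^'n \<Rightarrow> real) \<Rightarrow> bool" where
  "sphere_sos u \<longleftrightarrow> (\<exists>hs. (\<forall>h\<in>set hs. polynomial_fun h) \<and>
     (\<forall>z\<in>sphere 0 1. u z = (\<Sum>h\<leftarrow>hs. (cmod (h z))\<^sup>2)))"

lemma sphere_sos_cong: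
  assumes "sphere_sos u" "\<And>z. norm z = 1 \<Longrightarrow> v z = u z"
  shows "sphere_sos v"
  using assms unfolding sphere_sos_def by auto

lemma sphere_sos_cmod_power2:
  assumes "polynomial_fun h"
  shows "sphere_sos (\<lambda>z. (cmod (h z))\<^sup>2)"
  unfolding sphere_sos_def using assms by (intro exI[of _ "[h]"]) simp

lemma sphere_sos_const:
  assumes "c \<ge> 0"
  shows "sphere_sos (\<lambda>_. c)"
  using sphere_sos_cmod_power2[OF polynomial_fun_const[of "of_real (sqrt c)"]] assms by simp

lemma sphere_sos_add:
  assumes "sphere_sos u" "sphere_sos v"
  shows "sphere_sos (\<lambda>z. u z + v z)"
proof -
  obtain hs where "\<forall>h\<in>set hs. polynomial_fun h"
    "\<forall>z\<in>sphere 0 1. u z = (\<Sum>h\<leftarrow>hs. (cmod (h z))\<^sup>2)"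
    using assms(1) unfolding sphere_sos_def by (elim exE conjE) (rule that)
  moreover obtain gs where "\<forall>h\<in>set gs. polynomial_fun h"
    "\<forall>z\<in>sphere 0 1. v z = (\<Sum>h\<leftarrow>gs. (cmod (h z))\<^sup>2)"
    using assms(2) unfolding sphere_sos_def by (elim exE conjE) (rule that)
  ultimately show ?thesis
    unfolding sphere_sos_def by (intro exI[of _ "hs @ gs"]) auto
qed

text \<open>The squared norm of a tensor product is the product of the squared norms. This gives
  closure under multiplication, and later the norm of \<open>z \<otimes> h\<close>.\<close>

lemma sum_list_cmod_products:
  "(\<Sum>f\<leftarrow>concat (map (\<lambda>h. map (\<lambda>g z. h z * g z) gs) hs). (cmod (f z))\<^sup>2) =
     (\<Sum>h\<leftarrow>hs. (cmod (h z))\<^sup>2) * (\<Sum>g\<leftarrow>gs. (cmod (g z))\<^sup>2)"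
  by (induction hs)
    (simp_all add: o_def norm_mult power_mult_distrib sum_list_const_mult distrib_right)

lemma sphere_sos_mult:
  assumes "sphere_sos u" "sphere_sos v"
  shows "sphere_sos (\<lambda>z. u z * v z)"
proof -
  obtain hs where hs: "\<forall>h\<in>set hs. polynomial_fun h"
    "\<forall>z\<in>sphere 0 1. u z = (\<Sum>h\<leftarrow>hs. (cmod (h z))\<^sup>2)"
    using assms(1) unfolding sphere_sos_def by (elim exE conjE) (rule that)
  obtain gs where gs: "\<forall>h\<in>set gs. polynomial_fun h"
    "\<forall>z\<in>sphere 0 1. v z = (\<Sum>h\<leftarrow>gs. (cmod (h z))\<^sup>2)"
    using assms(2) unfolding sphere_sos_def by (elim exE conjE) (rule that)
  show ?thesis
    unfolding sphere_sos_def
  proof (intro exI conjI ballI)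
    show "polynomial_fun f" if "f \<in> set (concat (map (\<lambda>h. map (\<lambda>g z. h z * g z) gs) hs))" for f
      using that hs(1) gs(1) by (auto intro: polynomial_fun_mult)
    show "u z * v z = (\<Sum>f\<leftarrow>concat (map (\<lambda>h. map (\<lambda>g z. h z * g z) gs) hs). (cmod (f z))\<^sup>2)"
      if "z \<in> sphere 0 1" for z
      unfolding sum_list_cmod_products using that hs(2) gs(2) by simp
  qed
qed

lemma sphere_sos_sum:
  "(\<And>j. j \<in> J \<Longrightarrow> sphere_sos (u j)) \<Longrightarrow> sphere_sos (\<lambda>z. \<Sum>j\<in>J. u j z)"
  by (induction J rule: infinite_finite_induct) (simp_all add: sphere_sos_const sphere_sos_add)

lemma sphere_sos_prod:
  "(\<And>j. j \<in> J \<Longrightarrow> sphere_sos (u j)) \<Longrightarrow> sphere_sos (\<lambda>z. \<Prod>j\<in>J. u j z)"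
  by (induction J rule: infinite_finite_induct) (simp_all add: sphere_sos_const sphere_sos_mult)

lemma sphere_sos_power: "sphere_sos u \<Longrightarrow> sphere_sos (\<lambda>z. u z ^ m)"
  by (induction m) (simp_all add: sphere_sos_const sphere_sos_mult)

text \<open>On the sphere, \<open>2 + 2 Re w = |1 + w|\<^sup>2 + (1 - |w|\<^sup>2)\<close> for \<open>w = a z\<^sub>i\<close>, and
  \<open>1 - |w|\<^sup>2\<close> is the sum of the squared moduli of the other coordinates.\<close>

lemma sphere_sos_one_plus_Re:
  assumes a: "cmod a = 1"
  shows "sphere_sos (\<lambda>z. (1 + Re (a * z $ i)) / 2)"
proof (rule sphere_sos_cong)
  have "sphere_sos (\<lambda>z. 1 / 4 * ((cmod (1 + a * z $ i))\<^sup>2 + (\<Sum>j\<in>UNIV - {i}. (cmod (z $ j))\<^sup>2)))"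
    by (intro sphere_sos_mult sphere_sos_const sphere_sos_add sphere_sos_sum sphere_sos_cmod_power2
        polynomial_fun_add polynomial_fun_mult polynomial_fun_const polynomial_fun_coord) simp
  then show "sphere_sos (\<lambda>z. 1 / 4 * ((cmod (1 + a * z $ i))\<^sup>2 + (\<Sum>j\<in>UNIV - {i}. (cmod (z $ j))\<^sup>2)))" .
  fix z :: "complex^'a" assume "norm z = 1"
  then have "(\<Sum>j\<in>UNIV. (cmod (z $ j))\<^sup>2) = 1"
    using norm_vec_power2[of z] by simp
  then have "(\<Sum>j\<in>UNIV - {i}. (cmod (z $ j))\<^sup>2) = 1 - (cmod (a * z $ i))\<^sup>2"
    by (simp add: sum_diff1 norm_mult a)
  moreover have "(cmod (1 + w))\<^sup>2 = 1 + 2 * Re w + (cmod w)\<^sup>2" for w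
    unfolding cmod_power2 by (simp add: power2_eq_square algebra_simps)
  ultimately show "(1 + Re (a * z $ i)) / 2 =
      1 / 4 * ((cmod (1 + a * z $ i))\<^sup>2 + (\<Sum>j\<in>UNIV - {i}. (cmod (z $ j))\<^sup>2))"
    by simp
qed

section \<open>From positivity on the sphere to membership in the semiring\<close>

text \<open>The set where \<open>r \<le> 0\<close> is compact and \<open>q\<close> is positive on
  it, hence bounded below there by a positive constant; a large multiple of \<open>q\<close>
  outweighs the minimum of \<open>r\<close>. Elsewhere \<open>r\<close> is already positive.
  Compactness then turns positivity into a uniform bound.\<close>

lemma compact_positive_combination:
  fixes r q :: "'a::topological_space \<Rightarrow> real"
  assumes K: "compact K" and r: "continuous_on K r" and q: "continuous_on K q"
    and nonneg: "\<And>x. x \<in> K \<Longrightarrow> q x \<ge> 0"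
    and pos: "\<And>x. x \<in> K \<Longrightarrow> q x = 0 \<Longrightarrow> r x > 0"
  obtains C \<delta> where "\<delta> > 0" "\<And>x. x \<in> K \<Longrightarrow> r x + C * q x \<ge> \<delta>"
proof -
  have "\<exists>C. \<forall>x\<in>K. r x + C * q x > 0"
  proof (cases "\<exists>x\<in>K. r x \<le> 0")
    case False
    then show ?thesis
      by (intro exI[of _ 0]) auto
  next
    case True
    define L where "L = K \<inter> r -` {..0}"
    have L: "compact L" "L \<noteq> {}" "L \<subseteq> K"
      using True K closedin_compact continuous_closedin_preimage[OF r closed_atMost]
      unfolding L_def by auto
    obtain x0 where x0: "x0 \<in> L" "\<And>x. x \<in> L \<Longrightarrow> q x0 \<le> q x"
      using continuous_attains_inf[OF L(1,2) continuous_on_subset[OF q L(3)]] by blast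
    obtain x1 where x1: "\<And>x. x \<in> K \<Longrightarrow> r x1 \<le> r x"
      using continuous_attains_inf[OF K _ r] L by blast
    have "q x0 > 0"
      using x0(1) pos[of x0] nonneg[of x0] unfolding L_def by fastforce
    \<comment> \<open>Chosen so that \<open>C * q x0 = \<bar>r x1\<bar> + 1\<close>, where
      \<open>q x0\<close> is the minimum of \<open>q\<close> on \<open>L\<close> and
      \<open>r x1\<close> the minimum of \<open>r\<close> on \<open>K\<close>.\<close>
    define C where "C = (\<bar>r x1\<bar> + 1) / q x0"
    have "C \<ge> 0"
      using \<open>q x0 > 0\<close> by (simp add: C_def)
    have "r x + C * q x > 0" if "x \<in> K" for x
    proof (cases "x \<in> L")
      case True
      have "C * q x \<ge> C * q x0"
        using x0(2)[OF True] \<open>C \<ge> 0\<close> by (rule mult_left_mono)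
      then show ?thesis
        using x1[OF that] \<open>q x0 > 0\<close> by (simp add: C_def)
    next
      case False
      then show ?thesis
        using that nonneg[OF that] \<open>C \<ge> 0\<close> by (simp add: L_def add_pos_nonneg)
    qed
    then show ?thesis
      by blast
  qed
  then obtain C where C: "\<And>x. x \<in> K \<Longrightarrow> r x + C * q x > 0"
    by blast
  show ?thesis
  proof (cases "K = {}")
    case True
    then show ?thesis
      using that[of 1] by simp
  next
    case False
    have "continuous_on K (\<lambda>x. r x + C * q x)"
      by (intro continuous_intros r q)
    then obtain y where "y \<in> K" "\<And>x. x \<in> K \<Longrightarrow> r y + C * q y \<le> r x + C * q x"
      using continuous_attains_inf[OF K False] by blast
    then show ?thesis
      using that[of "r y + C * q y" C] C by blast
  qed
qed

text \<open>Adding a multiple of \<open>(\<parallel>z\<parallel>\<^sup>2 - 1)\<^sup>2\<close> does not change values on the sphere and achieves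
  positivity on the cube in which all \<open>Re z\<^sub>i\<close> and \<open>Im z\<^sub>i\<close> range over \<open>[-1, 1]\<close>; the Bernstein
  expansion then lies in the semiring.\<close>

lemma sphere_sos_one_minus:
  fixes p :: "nat \<Rightarrow> complex^'n \<Rightarrow> complex"
  assumes p: "\<And>j. j < k \<Longrightarrow> polynomial_fun (p j)"
    and less1: "\<And>z. norm z = 1 \<Longrightarrow> (\<Sum>j<k. (cmod (p j z))\<^sup>2) < 1"
  shows "sphere_sos (\<lambda>z. 1 - (\<Sum>j<k. (cmod (p j z))\<^sup>2))"
proof -
  \<comment> \<open>The radius makes \<open>K\<close> contain the cube: each complex coordinate
    there has modulus at most 2.\<close>
  define K :: "(complex^'n) set" where "K = cball 0 (2 * real CARD('n))"
  define r where "r z = 1 - (\<Sum>j<k. (cmod (p j z))\<^sup>2)" for z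
  define q where "q z = ((norm z)\<^sup>2 - 1)\<^sup>2" for z :: "complex^'n"
  obtain C \<delta> where \<delta>: "\<delta> > 0" and C: "\<And>z. z \<in> K \<Longrightarrow> r z + C * q z \<ge> \<delta>"
  proof (rule compact_positive_combination[of K r q])
    show "continuous_on K r"
      unfolding r_def by (intro continuous_intros continuous_on_polynomial_fun p) auto
    show "continuous_on K q"
      unfolding q_def by (intro continuous_intros)
    show "r z > 0" if "q z = 0" for z
    proof -
      have "(norm z)\<^sup>2 = 1"
        using that by (simp add: q_def)
      then have "norm z = 1"
        by (metis norm_ge_zero power2_eq_1_iff abs_norm_cancel abs_1 abs_minus_cancel)
      then show ?thesis
        using less1 by (simp add: r_def)
    qed
  qed (auto simp: K_def q_def)
  \<comment> \<open>Affine parametrization by the unit cube of the cube with sides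
    \<open>[-1, 1]\<close>; the index \<open>True\<close> stands for real parts,
    \<open>False\<close> for imaginary parts.\<close>
  define w :: "('n \<times> bool \<Rightarrow> real) \<Rightarrow> complex^'n"
    where "w t = (\<chi> i. Complex (2 * t (i, True) - 1) (2 * t (i, False) - 1))" for t
  define F where "F t = r (w t) + C * q (w t)" for t
  have Re_w: "real_mpoly (\<lambda>t. Re (w t $ i))" and Im_w: "real_mpoly (\<lambda>t. Im (w t $ i))" for i
    unfolding w_def
    by (simp_all add: real_mpoly_diff real_mpoly_mult real_mpoly_const real_mpoly_coord)
  have mpoly: "real_mpoly F"
    unfolding F_def r_def q_def norm_vec_power2 cmod_power2
    by (intro real_mpoly.add real_mpoly_mult real_mpoly_const real_mpoly_diff real_mpoly_sum
        real_mpoly_power2 Re_w Im_w real_mpoly_polynomial_fun[THEN conjunct1]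
        real_mpoly_polynomial_fun[THEN conjunct2] p) auto
  have "\<forall>t. (\<forall>i. 0 \<le> t i \<and> t i \<le> 1) \<longrightarrow> F t \<ge> \<delta>"
  proof (intro allI impI)
    fix t :: "'n \<times> bool \<Rightarrow> real" assume t: "\<forall>i. 0 \<le> t i \<and> t i \<le> 1"
    have "norm (w t) \<le> (\<Sum>i\<in>UNIV. cmod (w t $ i))"
      by (simp add: norm_vec_def L2_set_le_sum)
    also have "\<dots> \<le> (\<Sum>i\<in>(UNIV :: 'n set). 2)"
    proof (rule sum_mono)
      fix i
      have "\<bar>2 * t (i, b) - 1\<bar> \<le> 1" for b
        using t[rule_format, of "(i, b)"] by linarith
      then show "cmod (w t $ i) \<le> 2"
        using cmod_le[of "w t $ i"] by (simp add: w_def) (smt (verit))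
    qed
    finally show "F t \<ge> \<delta>"
      unfolding F_def by (intro C) (simp add: K_def)
  qed
  from real_mpoly_nonneg_Bernstein_coeffs[OF mpoly \<delta> this] obtain N c where
    c: "\<forall>\<kappa>\<in>UNIV \<rightarrow>\<^sub>E {..N}. c \<kappa> \<ge> 0" and
    F: "\<forall>t. F t = (\<Sum>\<kappa>\<in>UNIV \<rightarrow>\<^sub>E {..N}. c \<kappa> * (\<Prod>i\<in>UNIV. Bernstein N (\<kappa> i) (t i)))"
    by (elim exE conjE) (rule that)
  \<comment> \<open>The inverse of \<open>w\<close>. Its entries and their complements to 1 are the
    factors of the Bernstein polynomials.\<close>
  define \<tau> where "\<tau> z = (\<lambda>(i, b). if b then (1 + Re (z $ i)) / 2 else (1 + Im (z $ i)) / 2)"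
    for z :: "complex^'n"
  have "sphere_sos (\<lambda>z. \<tau> z i)" for i
    \<comment> \<open>The imaginary part arises as \<open>Re (-\<i> * z) = Im z\<close>; the
      complements below use the opposite factors \<open>-1\<close> and \<open>\<i>\<close>.\<close>
    using sphere_sos_one_plus_Re[of 1 "fst i"] sphere_sos_one_plus_Re[of "-\<i>" "fst i"]
    by (cases i; cases "snd i") (simp_all add: \<tau>_def)
  moreover have "sphere_sos (\<lambda>z. 1 - \<tau> z i)" for i
  proof (rule sphere_sos_cong)
    show "sphere_sos (\<lambda>z. (1 + Re ((if snd i then -1 else \<i>) * z $ fst i)) / 2)"
      by (rule sphere_sos_one_plus_Re) simp
  qed (cases i; simp add: \<tau>_def field_simps)
  ultimately have "sphere_sos (\<lambda>z. F (\<tau> z))"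
    unfolding F[rule_format] Bernstein_def
    by (intro sphere_sos_sum sphere_sos_mult sphere_sos_prod sphere_sos_power sphere_sos_const) (auto simp: c)
  then show ?thesis
  proof (rule sphere_sos_cong)
    fix z :: "complex^'n" assume "norm z = 1"
    \<comment> \<open>Hence \<open>F (\<tau> z) = r z + C * q z\<close>, and \<open>q\<close>
      vanishes on the sphere.\<close>
    moreover have "w (\<tau> z) = z"
      by (simp add: w_def \<tau>_def vec_eq_iff complex_eq_iff field_simps)
    ultimately show "1 - (\<Sum>j<k. (cmod (p j z))\<^sup>2) = F (\<tau> z)"
      by (simp add: F_def r_def q_def)
  qed
qed

section \<open>Direct sums and properness of polynomial ball maps\<close>

lemma sum_direct_sum_map:
  "(\<Sum>i<k + M. (cmod (direct_sum_map k p g z i))\<^sup>2) =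
     (\<Sum>i<k. (cmod (p z i))\<^sup>2) + (\<Sum>i<M. (cmod (g z i))\<^sup>2)"
  by (induction M) (simp_all add: direct_sum_map_def)

text \<open>The map is continuous on the whole space and takes the sphere to the sphere. The
  preimage in the closed ball of a compact subset of the open target ball is therefore compact and
  misses the boundary.\<close>

lemma proper_holomorphic_ball_map_polynomial:
  fixes f :: "complex^'n \<Rightarrow> nat \<Rightarrow> complex"
  assumes f: "polynomial_map N f"
    and inside: "\<And>z. norm z < 1 \<Longrightarrow> cnorm N (f z) < 1"
    and boundary: "\<And>z. norm z = 1 \<Longrightarrow> cnorm N (f z) = 1"
  shows "proper_holomorphic_ball_map N f"
proof -
  have cspace: "f z \<in> cspace N" and poly: "j < N \<Longrightarrow> polynomial_fun (\<lambda>z. f z j)" for z j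
    using f by (auto simp: polynomial_map_def)
  have hol: "holomorphic_map_on N f (ball 0 1)"
    using cspace poly by (simp add: holomorphic_map_on_def polynomial_fun_imp_holomorphic_fun_on)
  have im: "f ` ball 0 1 \<subseteq> unit_ball N"
    using cspace inside by (auto simp: unit_ball_def)
  have "continuous_on UNIV (\<lambda>z. f z j)" for j
  proof (cases "j < N")
    case True
    then show ?thesis
      by (intro continuous_on_polynomial_fun poly)
  next
    case False
    then have "(\<lambda>z. f z j) = (\<lambda>_. 0)"
      using cspace by (auto simp: cspace_def)
    then show ?thesis
      by (metis continuous_on_const)
  qed
  then have cont: "continuous_on UNIV f"
    by (rule continuous_on_coordinatewise_then_product)
  have "compact {z \<in> ball 0 1. f z \<in> K}" if "K \<subseteq> unit_ball N" "compact K" for K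
  proof -
    have "norm z \<noteq> 1" if "f z \<in> K" for z
      using that \<open>K \<subseteq> unit_ball N\<close> boundary[of z] by (auto simp: unit_ball_def)
    then have "{z \<in> ball 0 1. f z \<in> K} = cball 0 1 \<inter> f -` K"
      by (auto simp: less_le)
    moreover have "closed (f -` K)"
      using cont compact_imp_closed[OF \<open>compact K\<close>] by (simp add: continuous_closed_vimage continuous_on_eq_continuous_at)
    ultimately show ?thesis
      by (simp add: compact_Int_closed)
  qed
  then show ?thesis
    using hol im by (simp add: proper_holomorphic_ball_map_def proper_ball_map_iff_compact_preimage)
qed

section \<open>Completing \<open>p\<close> by a tensor product with the identity\<close>

theorem theorem2:
  fixes p :: "complex^'n \<Rightarrow> nat \<Rightarrow> complex" and k :: nat
  assumes "k \<ge> 1"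
    and "polynomial_map k p"
    and "\<forall>z\<in>sphere 0 1. (cnorm k (p z))\<^sup>2 < 1"
  shows "\<exists>N g. N > k \<and> polynomial_map (N - k) g \<and>
           proper_holomorphic_ball_map N (direct_sum_map k p g)"
proof -
  have p: "polynomial_fun (\<lambda>z. p z j)" if "j < k" for j
    using assms(2) that by (simp add: polynomial_map_def)
  have less1: "(\<Sum>j<k. (cmod (p z j))\<^sup>2) < 1" if "norm z = 1" for z
    using assms(3) that by (simp add: cnorm_power2)
  have sos: "sphere_sos (\<lambda>z. 1 - (\<Sum>j<k. (cmod (p z j))\<^sup>2))"
    using p less1 by (rule sphere_sos_one_minus)
  obtain hs where hs: "\<forall>h\<in>set hs. polynomial_fun h"
    "\<forall>z\<in>sphere 0 1. 1 - (\<Sum>j<k. (cmod (p z j))\<^sup>2) = (\<Sum>h\<leftarrow>hs. (cmod (h z))\<^sup>2)"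
    using sos unfolding sphere_sos_def
    by (elim exE conjE) (rule that)
  have sphere1: "(\<Sum>j<k. (cmod (p z j))\<^sup>2) + (\<Sum>h\<leftarrow>hs. (cmod (h z))\<^sup>2) = 1" if "norm z = 1" for z
    using hs(2)[rule_format, of z] that by simp
  \<comment> \<open>The tensor product of \<open>z\<close> with \<open>hs\<close>, rather than \<open>hs\<close> itself: it forces the sum to be
    strictly less than 1 inside the ball.\<close>
  obtain xs :: "'n list" where xs: "set xs = UNIV" "distinct xs"
    using finite_distinct_list[of "UNIV :: 'n set"] by auto
  define gs where "gs = concat (map (\<lambda>h. map (\<lambda>g z. h z * g z) hs) (map (\<lambda>i z. z $ i) xs))"
  have gs: "polynomial_fun g" if "g \<in> set gs" for g
    using that hs(1) by (auto simp: gs_def intro: polynomial_fun_mult polynomial_fun_coord)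
  have sum_gs: "(\<Sum>g\<leftarrow>gs. (cmod (g z))\<^sup>2) = (norm z)\<^sup>2 * (\<Sum>h\<leftarrow>hs. (cmod (h z))\<^sup>2)" for z
    unfolding gs_def sum_list_cmod_products norm_vec_power2
    by (simp add: o_def sum_list_distinct_conv_sum_set xs)
  define M where "M = length gs"
  define g where "g z j = (if j < M then (gs ! j) z else 0)" for z j
  have g: "polynomial_map M g"
    using gs by (simp add: polynomial_map_def cspace_def g_def M_def)
  have sum_g: "(\<Sum>j<M. (cmod (g z j))\<^sup>2) = (norm z)\<^sup>2 * (\<Sum>h\<leftarrow>hs. (cmod (h z))\<^sup>2)" for z
    unfolding sum_gs[symmetric] by (simp add: g_def M_def sum_list_sum_nth atLeast0LessThan)
  define f where "f = direct_sum_map k p g"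
  have f: "polynomial_map (k + M) f"
    unfolding polynomial_map_def
  proof (intro conjI allI impI)
    show "f z \<in> cspace (k + M)" for z
      by (auto simp: f_def direct_sum_map_def cspace_def g_def)
    show "polynomial_fun (\<lambda>z. f z j)" if "j < k + M" for j
      using that p[of j] g by (cases "j < k") (simp_all add: f_def direct_sum_map_def polynomial_map_def)
  qed
  have cnorm_f: "(cnorm (k + M) (f z))\<^sup>2 =
      (\<Sum>j<k. (cmod (p z j))\<^sup>2) + (norm z)\<^sup>2 * (\<Sum>h\<leftarrow>hs. (cmod (h z))\<^sup>2)" for z
    unfolding cnorm_power2 f_def sum_direct_sum_map sum_g ..
  have nonneg: "cnorm (k + M) v \<ge> 0" for v
    by (simp add: cnorm_def)
  have boundary: "cnorm (k + M) (f z) = 1" if "norm z = 1" for z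
    using cnorm_f[of z] sphere1[OF that] that nonneg[of "f z"] by (simp add: power2_eq_1_iff)
  \<comment> \<open>The maximum of the squared norm of \<open>p\<close> on the compact sphere; a
    bound strictly below 1 is what yields strictness inside the ball.\<close>
  obtain s where s: "0 \<le> s" "s < 1" "\<And>z. norm z = 1 \<Longrightarrow> (\<Sum>j<k. (cmod (p z j))\<^sup>2) \<le> s"
  proof -
    have "continuous_on (sphere 0 1) (\<lambda>z. \<Sum>j<k. (cmod (p z j))\<^sup>2)"
      by (intro continuous_intros continuous_on_polynomial_fun p) auto
    then obtain z0 where "z0 \<in> sphere 0 1"
      "\<And>z. z \<in> sphere 0 1 \<Longrightarrow> (\<Sum>j<k. (cmod (p z j))\<^sup>2) \<le> (\<Sum>j<k. (cmod (p z0 j))\<^sup>2)"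
      using continuous_attains_sup[of "sphere 0 1" "\<lambda>z. \<Sum>j<k. (cmod (p z j))\<^sup>2"] by auto
    then show ?thesis
      using that[of "\<Sum>j<k. (cmod (p z0 j))\<^sup>2"] less1[of z0] by (simp add: sum_nonneg)
  qed
  have inside: "cnorm (k + M) (f z) < 1" if z: "norm z < 1" for z
  proof -
    define a where "a = (\<Sum>j<k. (cmod (p z j))\<^sup>2)"
    define b where "b = (\<Sum>h\<leftarrow>hs. (cmod (h z))\<^sup>2)"
    define x where "x = (norm z)\<^sup>2"
    have "a \<le> s"
      unfolding a_def
      by (rule polynomial_maximum_principle[where f = "\<lambda>j z. p z j"]) (use z in \<open>simp_all add: p s\<close>)
    have sum_dh: "(\<Sum>j<k + length hs. (cmod (direct_sum_map k p (\<lambda>z j. (hs ! j) z) z j))\<^sup>2) =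
        (\<Sum>j<k. (cmod (p z j))\<^sup>2) + (\<Sum>h\<leftarrow>hs. (cmod (h z))\<^sup>2)" for z
      unfolding sum_direct_sum_map by (simp add: sum_list_sum_nth atLeast0LessThan)
    \<comment> \<open>The maximum principle for the direct sum of \<open>p\<close> and
      \<open>hs\<close>, whose squared norm is 1 on the sphere.\<close>
    have "a + b \<le> 1"
      unfolding a_def b_def sum_dh[symmetric]
    proof (rule polynomial_maximum_principle[where f = "\<lambda>j z. direct_sum_map k p (\<lambda>z j. (hs ! j) z) z j"])
      show "polynomial_fun (\<lambda>z. direct_sum_map k p (\<lambda>z j. (hs ! j) z) z j)" if "j < k + length hs" for j
        using that p[of j] hs(1) by (cases "j < k") (simp_all add: direct_sum_map_def)
    qed (use z in \<open>simp_all add: sphere1 sum_dh\<close>)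
    have x: "0 \<le> x" "x < 1"
      using z by (simp_all add: x_def power_less_one_iff abs_square_less_1)
    \<comment> \<open>A convex combination of \<open>a + b \<le> 1\<close> and
      \<open>a \<le> s < 1\<close>, in which the second has positive weight
      \<open>1 - x\<close>.\<close>
    have "a + x * b = x * (a + b) + (1 - x) * a"
      by (simp add: algebra_simps)
    also have "\<dots> \<le> x * 1 + (1 - x) * s"
      using \<open>a + b \<le> 1\<close> \<open>a \<le> s\<close> x by (intro add_mono mult_left_mono) auto
    also have "\<dots> = 1 - (1 - x) * (1 - s)"
      by (simp add: algebra_simps)
    also have "\<dots> < 1"
      using x s by simp
    finally have "(cnorm (k + M) (f z))\<^sup>2 < 1"
      by (simp add: cnorm_f a_def b_def x_def)
    then show ?thesis
      using nonneg[of "f z"] by (simp add: abs_square_less_1)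
  qed
  \<comment> \<open>This yields \<open>N > k\<close>. With no components in \<open>g\<close>, the
    sum over \<open>hs\<close> would vanish at a unit vector, so \<open>p\<close> would have norm 1
    there.\<close>
  have "M > 0"
  proof (rule ccontr)
    assume "\<not> M > 0"
    moreover have "norm (axis undefined 1 :: complex^'n) = 1"
      by (simp add: norm_axis_1)
    ultimately show False
      using sphere1 less1 sum_g[of "axis undefined 1"] by fastforce
  qed
  then show ?thesis
    using g proper_holomorphic_ball_map_polynomial[OF f inside boundary]
    by (intro exI[of _ "k + M"] exI[of _ g]) (simp add: f_def)
qed

end
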